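(* For an integer $n\ge 1$, let $c_{n,o}$ (respectively $c_{n,e}$) be the number of odd (respectively even) compositions of $n+1$ all of whose parts are greater than one, and define $b_n := c_{n,o}-c_{n,e}$. Then $b_n=(-1)^j$ if $n\in\{3j+1,\,3j+2\}$ for some integer $j\ge 0$, and $b_n=0$ otherwise.
   Context: A composition of a nonnegative integer $N$ is a finite sequence $\alpha=(\alpha_1,\ldots,\alpha_\ell)$ of positive integers with $\alpha_1+\cdots+\alpha_\ell=N$; the $\alpha_i$ are its parts and $\ell$ is its length. A composition is called even (respectively odd) if its length $\ell$ is even (respectively odd). *)

theory Defs
  imports Complex_Main
begin

definition compositions :: "nat \<Rightarrow> nat list set" where
  "compositions N = {\<alpha>. (\<forall>a \<in> set \<alpha>. 0 < a) \<and> sum_list \<alpha> = N}"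

text \<open>Finiteness guarantees that the cardinalities below are genuine counts.\<close>

lemma length_le_sum_list:
  fixes xs :: "nat list"
  assumes "\<forall>a \<in> set xs. 0 < a"
  shows "length xs \<le> sum_list xs"
  using assms by (induction xs) auto

lemma finite_compositions: "finite (compositions N)"
proof (rule finite_subset)
  show "compositions N \<subseteq> {xs. set xs \<subseteq> {..N} \<and> length xs \<le> N}"
    using length_le_sum_list member_le_sum_list by (fastforce simp: compositions_def)
  show "finite {xs. set xs \<subseteq> {..N} \<and> length xs \<le> N}"
    by (rule finite_lists_length_le) simp
qed

definition even_composition :: "nat list \<Rightarrow> bool" where
  "even_composition \<alpha> \<longleftrightarrow> even (length \<alpha>)"

definition odd_composition :: "nat list \<Rightarrow> bool" where
  "odd_composition \<alpha> \<longleftrightarrow> odd (length \<alpha>)"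

definition c_odd :: "nat \<Rightarrow> nat" where
  "c_odd n = card {\<alpha> \<in> compositions (n + 1). odd_composition \<alpha> \<and> (\<forall>a \<in> set \<alpha>. 1 < a)}"

definition c_even :: "nat \<Rightarrow> nat" where
  "c_even n = card {\<alpha> \<in> compositions (n + 1). even_composition \<alpha> \<and> (\<forall>a \<in> set \<alpha>. 1 < a)}"

definition b :: "nat \<Rightarrow> int" where
  "b n = int (c_odd n) - int (c_even n)"

end

(* Removing a leading part 2, or lowering a leading part greater than 2 by one, splits the
   compositions of N + 2 with all parts greater than one into those of N (with the parity of the
   length flipped) and those of N + 1 (with the parity kept). The signed counts therefore satisfy
   s(N + 2) = s(N + 1) - s(N), which implies s(N + 3) = - s(N). *)

theory Submission
  imports Defs
begin

definition big_compositions :: "nat \<Rightarrow> nat list set" where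
  "big_compositions N = {\<alpha>. (\<forall>a \<in> set \<alpha>. 1 < a) \<and> sum_list \<alpha> = N}"

definition signed_count :: "nat \<Rightarrow> int" where
  "signed_count N = (\<Sum>\<alpha> \<in> big_compositions N. (-1) ^ length \<alpha>)"

lemma big_compositions_subset: "big_compositions N \<subseteq> compositions N"
  by (fastforce simp: big_compositions_def compositions_def)

lemma finite_big_compositions: "finite (big_compositions N)"
  using big_compositions_subset finite_compositions by (rule finite_subset)

text \<open>Odd lengths contribute -1 to \<open>signed_count\<close> and even lengths +1, whereas
  \<open>b\<close> counts odd minus even; hence the minus sign. The shift arises because
  \<open>b n\<close> concerns compositions of \<open>n + 1\<close>.\<close>

lemma b_eq_signed_count: "b n = - signed_count (n + 1)"
proof -
  let ?B = "big_compositions (n + 1)"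
  let ?O = "{\<alpha> \<in> ?B. odd (length \<alpha>)}" and ?E = "{\<alpha> \<in> ?B. even (length \<alpha>)}"
  have "c_odd n = card ?O" "c_even n = card ?E"
    unfolding c_odd_def c_even_def odd_composition_def even_composition_def
      big_compositions_def compositions_def
    by (rule arg_cong[where f = card], fastforce)+
  moreover have "signed_count (n + 1) = (\<Sum>\<alpha>\<in>?O. (-1) ^ length \<alpha>) + (\<Sum>\<alpha>\<in>?E. (-1) ^ length \<alpha>)"
    unfolding signed_count_def
    by (subst sum.union_disjoint[symmetric])
      (auto simp: finite_big_compositions intro!: sum.cong)
  ultimately show ?thesis
    by (simp add: b_def)
qed

text \<open>Inverse of lowering the leading part by one. It is meaningful only on nonempty lists,
  since \<open>hd []\<close> is unspecified; compositions of a positive number are never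
  empty.\<close>

definition raise_head :: "nat list \<Rightarrow> nat list" where
  "raise_head \<alpha> = Suc (hd \<alpha>) # tl \<alpha>"

lemma big_compositions_Suc_not_Nil: "\<alpha> \<in> big_compositions (Suc N) \<Longrightarrow> \<alpha> \<noteq> []"
  by (auto simp: big_compositions_def)

lemma big_compositions_rec:
  "big_compositions (N + 2) = (#) 2 ` big_compositions N \<union> raise_head ` big_compositions (N + 1)"
proof (rule subset_antisym)
  show "big_compositions (N + 2)
      \<subseteq> (#) 2 ` big_compositions N \<union> raise_head ` big_compositions (N + 1)"
  proof
    fix \<alpha> assume \<alpha>: "\<alpha> \<in> big_compositions (N + 2)"
    then obtain a \<beta> where eq: "\<alpha> = a # \<beta>"
      using big_compositions_Suc_not_Nil by (cases \<alpha>) auto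
    show "\<alpha> \<in> (#) 2 ` big_compositions N \<union> raise_head ` big_compositions (N + 1)"
    proof (cases "a = 2")
      case True
      with \<alpha> eq have "\<beta> \<in> big_compositions N"
        by (simp add: big_compositions_def)
      with True eq show ?thesis by blast
    next
      case False
      \<comment> \<open>Here \<open>a\<close> is at least 3, so \<open>a - 1\<close> is still
        greater than one.\<close>
      with \<alpha> eq have "(a - 1) # \<beta> \<in> big_compositions (N + 1)" "\<alpha> = raise_head ((a - 1) # \<beta>)"
        by (auto simp: big_compositions_def raise_head_def)
      then show ?thesis by blast
    qed
  qed
  have "raise_head \<alpha> \<in> big_compositions (N + 2)" if "\<alpha> \<in> big_compositions (N + 1)" for \<alpha>
    using that by (cases \<alpha>) (auto simp: big_compositions_def raise_head_def)
  moreover have "2 # \<alpha> \<in> big_compositions (N + 2)" if "\<alpha> \<in> big_compositions N" for \<alpha>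
    using that by (auto simp: big_compositions_def)
  ultimately show "(#) 2 ` big_compositions N \<union> raise_head ` big_compositions (N + 1)
      \<subseteq> big_compositions (N + 2)"
    by blast
qed

lemma signed_count_rec: "signed_count (N + 2) = signed_count (N + 1) - signed_count N"
proof -
  let ?A = "(#) 2 ` big_compositions N" and ?C = "raise_head ` big_compositions (N + 1)"
  \<comment> \<open>A nonempty list is determined by its head and tail, and \<open>Suc\<close> is
    injective.\<close>
  have inj: "inj_on raise_head (big_compositions (N + 1))"
    by (rule inj_onI)
      (simp add: raise_head_def big_compositions_Suc_not_Nil list.expand)
  \<comment> \<open>Lists in \<open>?A\<close> begin with 2; those in \<open>?C\<close> begin with a
    raised part, hence with at least 3.\<close>
  have disj: "?A \<inter> ?C = {}"
  proof -
    have "hd \<alpha> > 1" if "\<alpha> \<in> big_compositions (N + 1)" for \<alpha>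
      using that by (cases \<alpha>) (auto simp: big_compositions_def)
    then show ?thesis
      by (force simp: raise_head_def)
  qed
  have len: "length (raise_head \<alpha>) = length \<alpha>" if "\<alpha> \<in> big_compositions (N + 1)" for \<alpha>
    using that big_compositions_Suc_not_Nil by (cases \<alpha>) (auto simp: raise_head_def)
  have "signed_count (N + 2) = (\<Sum>\<alpha>\<in>?A. (-1) ^ length \<alpha>) + (\<Sum>\<alpha>\<in>?C. (-1) ^ length \<alpha>)"
    unfolding signed_count_def big_compositions_rec
    by (rule sum.union_disjoint) (use disj in \<open>simp_all add: finite_big_compositions\<close>)
  \<comment> \<open>Prefixing 2 is injective and lengthens each list by one, which flips every
    sign.\<close>
  also have "(\<Sum>\<alpha>\<in>?A. (-1) ^ length \<alpha>) = - signed_count N"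
    by (simp add: signed_count_def sum.reindex sum_negf)
  also have "(\<Sum>\<alpha>\<in>?C. (-1) ^ length \<alpha>) = signed_count (N + 1)"
    unfolding signed_count_def sum.reindex[OF inj] by (rule sum.cong) (simp_all add: len)
  finally show ?thesis by simp
qed

text \<open>Two uses of the recurrence give s(N + 3) = (s(N + 1) - s(N)) - s(N + 1), where s(N + 1)
  cancels.\<close>

lemma signed_count_add_3: "signed_count (N + 3) = - signed_count N"
  using signed_count_rec[of "N + 1"] signed_count_rec[of N] by (simp add: numeral_eq_Suc)

lemma signed_count_0: "signed_count 0 = 1"
proof -
  have "big_compositions 0 = {[]}"
    by (auto simp: big_compositions_def) (metis last_in_set not_less_zero)
  then show ?thesis by (simp add: signed_count_def)
qed

lemma signed_count_1: "signed_count 1 = 0"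
proof -
  have "\<alpha> \<notin> big_compositions 1" for \<alpha>
    by (cases \<alpha>) (auto simp: big_compositions_def)
  then have "big_compositions 1 = {}" by blast
  then show ?thesis by (simp add: signed_count_def)
qed

text \<open>Iterates the sign change under a shift by 3. The offset \<open>r\<close> is arbitrary
  rather than a remainder, so that \<open>b_values\<close> can also take it to be 3.\<close>

lemma signed_count_3_times_add: "signed_count (3 * j + r) = (-1) ^ j * signed_count r"
proof (induction j)
  case (Suc j)
  then show ?case
    using signed_count_add_3[of "3 * j + r"] by (simp add: ac_simps)
qed simp

lemma b_values:
  "b (3 * j) = 0" "b (3 * j + 1) = (-1) ^ j" "b (3 * j + 2) = (-1) ^ j"
proof -
  \<comment> \<open>Because of the shift in \<open>b_eq_signed_count\<close>, the three values of
    \<open>b\<close> come from the offsets 1, 2 and 3. The signed count at 1 is 0; at 2 it is s(1) -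
    s(0), and at 3 it is -s(0).\<close>
  have "signed_count 2 = -1" "signed_count 3 = -1"
    using signed_count_rec[of 0] signed_count_add_3[of 0] signed_count_0 signed_count_1
    by (simp_all add: numeral_eq_Suc)
  then show "b (3 * j) = 0" "b (3 * j + 1) = (-1) ^ j" "b (3 * j + 2) = (-1) ^ j"
    using signed_count_3_times_add[of j 1] signed_count_3_times_add[of j 2]
      signed_count_3_times_add[of j 3] signed_count_1
    by (simp_all add: b_eq_signed_count numeral_eq_Suc)
qed

theorem theorem1p5:
  fixes n :: nat
  assumes "n \<ge> 1"
  shows "(\<forall>j::nat. n \<in> {3 * j + 1, 3 * j + 2} \<longrightarrow> b n = (-1) ^ j) \<and>
         ((\<nexists>j::nat. n \<in> {3 * j + 1, 3 * j + 2}) \<longrightarrow> b n = 0)"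
proof (intro conjI allI impI)
  show "b n = (-1) ^ j" if "n \<in> {3 * j + 1, 3 * j + 2}" for j
    using that b_values by auto
  assume no: "\<nexists>j. n \<in> {3 * j + 1, 3 * j + 2}"
  \<comment> \<open>The quotient serves as \<open>j\<close>: remainders 1 and 2 are excluded by
    \<open>no\<close>, which leaves the multiples of 3.\<close>
  have "n = 3 * (n div 3) \<or> n \<in> {3 * (n div 3) + 1, 3 * (n div 3) + 2}"
    by (simp, presburger)
  with no have "n = 3 * (n div 3)"
    by blast
  then show "b n = 0"
    using b_values(1)[of "n div 3"] by simp
qed

end
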